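(* Let $G$ be a finite group. Then $G$ is an elementary abelian $2$-group of rank at least $2$ if and only if the power graph $\mathcal{G}(G)$ is non-complete and minimally connected.
   Context: The power graph $\mathcal{G}(G)$ of a group $G$ is the simple undirected graph with vertex set $G$ in which two distinct vertices $u,v$ are adjacent if and only if $v=u^n$ for some positive integer $n$ or $u=v^m$ for some positive integer $m$. For a graph $\Gamma$, $\kappa(\Gamma)$ denotes its vertex connectivity. A non-trivial connected graph $\Gamma$ is minimally connected if $\kappa(\Gamma-\varepsilon)=\kappa(\Gamma)-1$ for every edge $\varepsilon$ of $\Gamma$. *)

theory Defs
  imports
    "HOL-Computational_Algebra.Primes"
    "HOL-Algebra.Multiplicative_Group"
    "Graph_Theory.Graph_Theory"
begin

text \<open>A simple undirected graph is a \<^locale>\<open>pair_graph\<close>: an edge is a pair of opposite arcs.\<close>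

definition power_graph :: "('a, 'm) monoid_scheme \<Rightarrow> 'a pair_pre_digraph" where
  "power_graph G =
    \<lparr> pverts = carrier G,
      parcs = {(u, v). u \<in> carrier G \<and> v \<in> carrier G \<and> u \<noteq> v \<and>
        ((\<exists>n::nat. 0 < n \<and> v = u [^]\<^bsub>G\<^esub> n) \<or> (\<exists>m::nat. 0 < m \<and> u = v [^]\<^bsub>G\<^esub> m))} \<rparr>"

lemma pair_graph_power_graph:
  assumes "finite (carrier G)"
  shows "pair_graph (power_graph G)"
proof
  have "parcs (power_graph G) \<subseteq> carrier G \<times> carrier G"
    by (auto simp: power_graph_def)
  then show "finite (parcs (power_graph G))"
    using assms finite_subset by blast
qed (use assms in \<open>auto simp: power_graph_def symmetric_def sym_def\<close>)

text \<open>
  The least number of vertices whose removal leaves a disconnected graph or a graph with a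
  single vertex; in particular the complete graph on \<open>n \<ge> 1\<close> vertices has connectivity \<open>n - 1\<close>.
\<close>

definition vertex_connectivity :: "('a, 'b) pre_digraph \<Rightarrow> nat" where
  "vertex_connectivity \<Gamma> =
    (LEAST k. \<exists>S \<subseteq> verts \<Gamma>. finite S \<and> card S = k \<and>
      (\<not> Digraph_Component.connected (\<Gamma> \<restriction> (verts \<Gamma> - S)) \<or> card (verts \<Gamma> - S) = 1))"

definition complete_graph :: "('a, 'b) pre_digraph \<Rightarrow> bool" where
  "complete_graph \<Gamma> \<longleftrightarrow> (\<exists>n. complete_digraph n \<Gamma>)"

definition delete_edge :: "'a pair_pre_digraph \<Rightarrow> 'a \<times> 'a \<Rightarrow> 'a pair_pre_digraph" where
  "delete_edge \<Gamma> e = \<Gamma>\<lparr> parcs := parcs \<Gamma> - {(fst e, snd e), (snd e, fst e)} \<rparr>"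

definition minimally_connected :: "'a pair_pre_digraph \<Rightarrow> bool" where
  "minimally_connected \<Gamma> \<longleftrightarrow>
    1 < card (pverts \<Gamma>) \<and> Digraph_Component.connected (with_proj \<Gamma>) \<and>
    (\<forall>e \<in> parcs \<Gamma>.
      int (vertex_connectivity (with_proj (delete_edge \<Gamma> e))) =
      int (vertex_connectivity (with_proj \<Gamma>)) - 1)"

definition elementary_abelian_group :: "nat \<Rightarrow> ('a, 'm) monoid_scheme \<Rightarrow> bool" where
  "elementary_abelian_group p G \<longleftrightarrow>
    prime p \<and> comm_group G \<and> (\<forall>x \<in> carrier G. x \<noteq> \<one>\<^bsub>G\<^esub> \<longrightarrow> group.ord G x = p)"

text \<open>
  The least size of a generating set; for \<open>(\<int>/p)\<^sup>r\<close> with \<open>p\<close> prime this is \<open>r\<close>.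
  It is only meaningful for finitely generated groups.
\<close>

definition group_rank :: "('a, 'm) monoid_scheme \<Rightarrow> nat" where
  "group_rank G =
    (LEAST k. \<exists>S \<subseteq> carrier G. finite S \<and> card S = k \<and> generate G S = carrier G)"

end

theory Submission
  imports Defs
begin

text \<open>
  Let \<open>k\<close> be the connectivity of a non-complete, minimally connected power graph. For \<open>x \<noteq> \<one>\<close> the
  edge \<open>{\<one>, x}\<close> can only matter for connectivity if every common neighbour of \<open>\<one>\<close> and \<open>x\<close> lies
  in a set of size \<open>k - 1\<close>; as \<open>\<one>\<close> is adjacent to everything, \<open>x\<close> has degree at most \<open>k\<close>.
  But \<open>x\<close> and \<open>x\<inverse>\<close> have the same closed neighbourhood, so if they differ, then deleting their
  at most \<open>k - 1\<close> common neighbours separates them from the rest of the group. Hence all elements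
  are involutions. Conversely, the power graph of an elementary abelian \<open>2\<close>-group is a star.
\<close>

section \<open>Vertex connectivity\<close>

lemma arcs_ends_induce_with_proj:
  "arcs_ends (with_proj \<Gamma> \<restriction> W) = parcs \<Gamma> \<inter> W \<times> W"
  by (auto simp: arcs_ends_def arc_to_ends_def)

text \<open>For the empty separating set, \<open>vertex_connectivity\<close> speaks of the subgraph
  induced on all vertices; this leads back to the graph itself.\<close>

lemma connected_induce_pverts: "connected (with_proj \<Gamma> \<restriction> pverts \<Gamma>) = connected (with_proj \<Gamma>)"
  if "parcs \<Gamma> \<subseteq> pverts \<Gamma> \<times> pverts \<Gamma>"
proof -
  have "arcs_ends (with_proj \<Gamma>) = parcs \<Gamma>"
    by (auto simp: arcs_ends_def arc_to_ends_def)
  moreover have "parcs \<Gamma> \<inter> pverts \<Gamma> \<times> pverts \<Gamma> = parcs \<Gamma>"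
    using that by blast
  ultimately show ?thesis
    by (simp add: connected_conv arcs_ends_induce_with_proj)
qed

text \<open>Any two vertices are joined by a walk through \<open>c\<close>. Walks of length two to
  \<open>c\<close> are allowed because, once an edge at the centre is deleted, its other end needs a
  detour.\<close>

lemma connected_induce_centre:
  assumes c: "c \<in> W"
    and reach: "\<And>v. v \<in> W \<Longrightarrow> v = c \<or> (v, c) \<in> parcs \<Gamma> \<or>
      (\<exists>w\<in>W. (v, w) \<in> parcs \<Gamma> \<and> (w, c) \<in> parcs \<Gamma>)"
  shows "connected (with_proj \<Gamma> \<restriction> W)"
proof -
  define R where "R = (parcs \<Gamma> \<inter> W \<times> W)\<^sup>s"
  have sym: "(a, b) \<in> R \<longleftrightarrow> (b, a) \<in> R" for a b
    by (auto simp: R_def symcl_def)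
  have step: "(a, b) \<in> R" if "(a, b) \<in> parcs \<Gamma>" "a \<in> W" "b \<in> W" for a b
    using that by (auto simp: R_def symcl_def)
  have edge: "(a, b) \<in> rtrancl_on W R" if "(a, b) \<in> R" "a \<in> W" "b \<in> W" for a b
    using that by (blast intro: converse_rtrancl_on_into_rtrancl_on)
  have to_c: "(v, c) \<in> rtrancl_on W R \<and> (c, v) \<in> rtrancl_on W R" if v: "v \<in> W" for v
  proof -
    have "v = c \<or> (v, c) \<in> R \<or> (\<exists>w\<in>W. (v, w) \<in> R \<and> (w, c) \<in> R)"
      using reach[OF v] step v c by blast
    then show ?thesis
    proof (elim disjE bexE conjE)
      fix w assume w: "w \<in> W" "(v, w) \<in> R" "(w, c) \<in> R"
      then show ?thesis
        using edge[of v w] edge[of w c] edge[of c w] edge[of w v] v c sym[of v w] sym[of w c]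
        by (auto intro: rtrancl_on_trans)
    qed (use edge[of v c] edge[of c v] v c sym[of v c] in auto)
  qed
  then have "(u, v) \<in> rtrancl_on W R" if "u \<in> W" "v \<in> W" for u v
    using that rtrancl_on_trans[of u c W R v] by blast
  then show ?thesis
    using c by (auto simp: connected_conv arcs_ends_induce_with_proj R_def)
qed

lemma not_connected_induce:
  assumes u: "u \<in> W \<inter> A" and v: "v \<in> W - A"
    and cut: "\<And>a b. a \<in> W \<inter> A \<Longrightarrow> b \<in> W - A \<Longrightarrow> (a, b) \<notin> parcs \<Gamma> \<and> (b, a) \<notin> parcs \<Gamma>"
  shows "\<not> connected (with_proj \<Gamma> \<restriction> W)"
proof
  assume "connected (with_proj \<Gamma> \<restriction> W)"
  then have "(u, v) \<in> rtrancl_on W ((parcs \<Gamma> \<inter> W \<times> W)\<^sup>s)"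
    using u v by (auto simp: connected_conv arcs_ends_induce_with_proj)
  \<comment> \<open>A walk inside \<open>W\<close> that starts in \<open>A\<close> can never leave
    \<open>A\<close>, since no arc crosses in either direction.\<close>
  then have "v \<in> A"
  proof (induction rule: rtrancl_on_induct)
    case base
    then show ?case using u by blast
  next
    case (step y z)
    then show ?case using cut by (auto simp: symcl_def)
  qed
  then show False using v by blast
qed

section \<open>Separating sets, degrees and vertex connectivity\<close>

lemma vertex_connectivity_le:
  assumes "S \<subseteq> pverts \<Gamma>" "finite S" "card S \<le> k"
    and "\<not> connected (with_proj \<Gamma> \<restriction> (pverts \<Gamma> - S)) \<or> card (pverts \<Gamma> - S) = 1"
  shows "vertex_connectivity (with_proj \<Gamma>) \<le> k"
proof -
  have "vertex_connectivity (with_proj \<Gamma>) \<le> card S"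
    unfolding vertex_connectivity_def
    using assms by (intro Least_le exI[of _ S]) auto
  then show ?thesis using assms by linarith
qed

lemma vertex_connectivity_witness:
  assumes "finite (pverts \<Gamma>)"
  obtains S where "S \<subseteq> pverts \<Gamma>" "finite S" "card S = vertex_connectivity (with_proj \<Gamma>)"
    "\<not> connected (with_proj \<Gamma> \<restriction> (pverts \<Gamma> - S)) \<or> card (pverts \<Gamma> - S) = 1"
proof -
  let ?P = "\<lambda>k. \<exists>S \<subseteq> pverts \<Gamma>. finite S \<and> card S = k \<and>
    (\<not> connected (with_proj \<Gamma> \<restriction> (pverts \<Gamma> - S)) \<or> card (pverts \<Gamma> - S) = 1)"
  \<comment> \<open>The empty graph does not count as connected, so removing all vertices is
    admissible and the \<open>LEAST\<close> is attained.\<close>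
  have "?P (card (pverts \<Gamma>))"
    using assms by (intro exI[of _ "pverts \<Gamma>"]) (auto simp: connected_conv)
  then have "?P (LEAST k. ?P k)" by (rule LeastI)
  then show ?thesis
    using that by (auto simp: vertex_connectivity_def)
qed

text \<open>Remove everything except \<open>x\<close> and \<open>y\<close>. The gap of 2 later rules
  out the clause of \<open>vertex_connectivity\<close> in which a single vertex remains.\<close>

lemma vertex_connectivity_nonadjacent:
  assumes fin: "finite (pverts \<Gamma>)" and "x \<in> pverts \<Gamma>" "y \<in> pverts \<Gamma>" "x \<noteq> y"
    and "(x, y) \<notin> parcs \<Gamma>" "(y, x) \<notin> parcs \<Gamma>"
  shows "vertex_connectivity (with_proj \<Gamma>) + 2 \<le> card (pverts \<Gamma>)"
proof -
  let ?S = "pverts \<Gamma> - {x, y}"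
  have "pverts \<Gamma> - ?S = {x, y}"
    using assms by blast
  moreover have "\<not> connected (with_proj \<Gamma> \<restriction> {x, y})"
    by (rule not_connected_induce[of x _ "{x}" y]) (use assms in auto)
  ultimately have "vertex_connectivity (with_proj \<Gamma>) \<le> card ?S"
    using fin by (intro vertex_connectivity_le[of ?S]) auto
  moreover have "card {x, y} \<le> card (pverts \<Gamma>)"
    using assms by (intro card_mono) auto
  ultimately show ?thesis
    using assms by (auto simp: card_Diff_subset)
qed

text \<open>A set of size \<open>k - 1\<close> that separates the graph without the edge must
  contain every neighbour of \<open>x\<close> other than \<open>c\<close>; adding \<open>c\<close>
  itself gives the bound \<open>k\<close>.\<close>

lemma degree_le_vertex_connectivity_of_centre_edge:
  fixes \<Gamma> :: "'a pair_pre_digraph"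
  defines "k \<equiv> vertex_connectivity (with_proj \<Gamma>)"
  assumes \<Gamma>: "pair_graph \<Gamma>"
    and c: "c \<in> pverts \<Gamma>" and c_adj: "\<And>v. v \<in> pverts \<Gamma> \<Longrightarrow> v \<noteq> c \<Longrightarrow> (v, c) \<in> parcs \<Gamma>"
    and x: "x \<in> pverts \<Gamma>" "x \<noteq> c"
    and k_le: "k + 2 \<le> card (pverts \<Gamma>)"
    and drop: "Suc (vertex_connectivity (with_proj (delete_edge \<Gamma> (c, x)))) = k"
  shows "card (parcs \<Gamma> `` {x}) \<le> k"
proof -
  interpret pair_graph \<Gamma> by (rule \<Gamma>)
  have sub: "parcs \<Gamma> \<subseteq> pverts \<Gamma> \<times> pverts \<Gamma>"
    by (auto dest: in_arcsD1 in_arcsD2)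
  have no_loop: "(x, x) \<notin> parcs \<Gamma>"
  proof
    assume "(x, x) \<in> parcs \<Gamma>"
    from no_loops[OF this] show False by simp
  qed
  have fin: "finite (pverts \<Gamma>)" by simp
  let ?D = "delete_edge \<Gamma> (c, x)"
  have [simp]: "pverts ?D = pverts \<Gamma>" "parcs ?D = parcs \<Gamma> - {(c, x), (x, c)}"
    by (auto simp: delete_edge_def)
  obtain S where S: "S \<subseteq> pverts \<Gamma>" "finite S" "Suc (card S) = k"
    and sep: "\<not> connected (with_proj ?D \<restriction> (pverts \<Gamma> - S)) \<or> card (pverts \<Gamma> - S) = 1"
    using vertex_connectivity_witness[of ?D] fin drop by auto
  \<comment> \<open>At least \<open>(k + 2) - (k - 1) = 3\<close> vertices remain.\<close>
  have "card (pverts \<Gamma> - S) \<noteq> 1"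
    using S k_le by (auto simp: card_Diff_subset)
  with sep have disc: "\<not> connected (with_proj ?D \<restriction> (pverts \<Gamma> - S))" by blast
  \<comment> \<open>If \<open>S\<close> met the deleted edge, then removing \<open>S\<close> from
    either graph would leave the same arcs, and \<open>S\<close> would separate the original graph
    with fewer than \<open>k\<close> vertices.\<close>
  have "c \<notin> S \<and> x \<notin> S"
  proof (rule ccontr)
    assume "\<not> (c \<notin> S \<and> x \<notin> S)"
    then have "arcs_ends (with_proj ?D \<restriction> (pverts \<Gamma> - S)) = arcs_ends (with_proj \<Gamma> \<restriction> (pverts \<Gamma> - S))"
      unfolding arcs_ends_induce_with_proj by auto
    with disc have "\<not> connected (with_proj \<Gamma> \<restriction> (pverts \<Gamma> - S))"
      by (simp add: connected_conv)
    then have "k \<le> card S"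
      unfolding k_def using S by (intro vertex_connectivity_le[of S]) auto
    then show False using S by simp
  qed
  have "parcs \<Gamma> `` {x} - {c} \<subseteq> S"
  proof (rule ccontr)
    assume "\<not> parcs \<Gamma> `` {x} - {c} \<subseteq> S"
    then obtain y where y: "(x, y) \<in> parcs \<Gamma>" "y \<noteq> c" "y \<notin> S" by blast
    have "y \<noteq> x" using y no_loop by blast
    \<comment> \<open>The path from \<open>x\<close> via \<open>y\<close> to \<open>c\<close>
      replaces the deleted edge; all other remaining vertices are still adjacent to
      \<open>c\<close>.\<close>
    have "connected (with_proj ?D \<restriction> (pverts \<Gamma> - S))"
    proof (rule connected_induce_centre[of c])
      show "c \<in> pverts \<Gamma> - S" using c \<open>c \<notin> S \<and> x \<notin> S\<close> by blast
      fix v assume v: "v \<in> pverts \<Gamma> - S"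
      have "y \<in> pverts \<Gamma>" using sub y by blast
      then show "v = c \<or> (v, c) \<in> parcs ?D \<or>
          (\<exists>w\<in>pverts \<Gamma> - S. (v, w) \<in> parcs ?D \<and> (w, c) \<in> parcs ?D)"
        using v c_adj y x \<open>y \<noteq> x\<close> by auto
    qed
    with disc show False by blast
  qed
  then have "card (parcs \<Gamma> `` {x}) \<le> card (insert c S)"
    using S by (intro card_mono) auto
  also have "\<dots> \<le> k"
    using S card_insert_le_m1[of k S c] by simp
  finally show ?thesis .
qed

lemma vertex_connectivity_less_degree_of_twins:
  assumes \<Gamma>: "pair_graph \<Gamma>"
    and xy: "(x, y) \<in> parcs \<Gamma>" "x \<noteq> y"
    and twins: "insert x (parcs \<Gamma> `` {x}) = insert y (parcs \<Gamma> `` {y})"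
    and z: "z \<in> pverts \<Gamma>" "z \<noteq> x" "(x, z) \<notin> parcs \<Gamma>"
  shows "vertex_connectivity (with_proj \<Gamma>) < card (parcs \<Gamma> `` {x})"
proof -
  interpret pair_graph \<Gamma> by (rule \<Gamma>)
  have sub: "parcs \<Gamma> \<subseteq> pverts \<Gamma> \<times> pverts \<Gamma>"
    by (auto dest: in_arcsD1 in_arcsD2)
  have sym: "sym (parcs \<Gamma>)"
    using sym_arcs by (simp add: symmetric_def)
  have fin: "finite (pverts \<Gamma>)" by simp
  \<comment> \<open>These are the common neighbours of the twins. Removing them cuts
    \<open>{x, y}\<close> off from \<open>z\<close>, and \<open>y\<close> is a neighbour of
    \<open>x\<close> outside the set, which makes the bound strict.\<close>
  let ?S = "parcs \<Gamma> `` {x} - {x, y}"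
  have N: "parcs \<Gamma> `` {x} \<subseteq> pverts \<Gamma>"
    using sub by blast
  then have fN: "finite (parcs \<Gamma> `` {x})"
    using fin finite_subset by blast
  have "\<not> connected (with_proj \<Gamma> \<restriction> (pverts \<Gamma> - ?S))"
  proof (rule not_connected_induce[of x _ "{x, y}" z])
    show "x \<in> (pverts \<Gamma> - ?S) \<inter> {x, y}" using sub xy by blast
    show "z \<in> (pverts \<Gamma> - ?S) - {x, y}" using z xy by blast
    fix a b assume a: "a \<in> (pverts \<Gamma> - ?S) \<inter> {x, y}" and b: "b \<in> (pverts \<Gamma> - ?S) - {x, y}"
    then have "(a, b) \<notin> parcs \<Gamma>" using twins by blast
    then show "(a, b) \<notin> parcs \<Gamma> \<and> (b, a) \<notin> parcs \<Gamma>"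
      using sym by (auto dest: symD)
  qed
  then have "vertex_connectivity (with_proj \<Gamma>) \<le> card ?S"
    using N fN by (intro vertex_connectivity_le[of ?S]) auto
  also have "\<dots> < card (parcs \<Gamma> `` {x})"
    using xy fN by (intro psubset_card_mono) auto
  finally show ?thesis .
qed

section \<open>The power graph\<close>

lemma pverts_power_graph [simp]: "pverts (power_graph G) = carrier G"
  by (simp add: power_graph_def)

context group
begin

section \<open>Adjacency to the identity and to inverses\<close>

lemma power_graph_adj_one:
  assumes "finite (carrier G)" "x \<in> carrier G" "x \<noteq> \<one>"
  shows "(x, \<one>) \<in> parcs (power_graph G)"
proof -
  have "0 < ord x \<and> \<one> = x [^] ord x"
    using assms ord_ge_1[of x] by simp
  then have "\<exists>n>0. \<one> = x [^] (n::nat)" ..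
  then show ?thesis
    using assms by (simp add: power_graph_def)
qed

lemma inv_eq_nat_pow:
  assumes "finite (carrier G)" "x \<in> carrier G"
  obtains n :: nat where "0 < n" "inv x = x [^] n"
proof
  \<comment> \<open>The exponent \<open>ord x - 1\<close> would be 0 for the identity; a further
    multiple of the order keeps it positive.\<close>
  have "x [^] (2 * ord x - 1) \<otimes> x = x [^] (Suc (2 * ord x - 1))"
    by simp
  also have "Suc (2 * ord x - 1) = ord x * 2"
    using ord_ge_1[OF assms] by simp
  also have "x [^] (ord x * 2) = \<one>"
    using assms by (simp flip: nat_pow_pow)
  finally show "inv x = x [^] (2 * ord x - 1)"
    using assms by (simp add: inv_equality)
  show "0 < 2 * ord x - 1"
    using ord_ge_1[OF assms] by simp
qed

text \<open>Each of \<open>x\<close> and \<open>inv x\<close> is a positive power of the other, so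
  composing exponents transfers both kinds of adjacency. The condition on \<open>y\<close> only
  excludes a loop.\<close>

lemma power_graph_adj_inv:
  assumes fin: "finite (carrier G)" and x: "x \<in> carrier G"
    and adj: "(x, y) \<in> parcs (power_graph G)" and y: "y \<noteq> inv x"
  shows "(inv x, y) \<in> parcs (power_graph G)"
proof -
  have yG: "y \<in> carrier G" using adj by (simp add: power_graph_def)
  from adj consider n :: nat where "0 < n" "y = x [^] n" | n :: nat where "0 < n" "x = y [^] n"
    by (auto simp: power_graph_def)
  then show ?thesis
  proof cases
    case 1
    obtain m :: nat where "0 < m" "inv (inv x) = inv x [^] m"
      using inv_eq_nat_pow[OF fin inv_closed[OF x]] .
    then have "0 < m * n \<and> y = inv x [^] (m * n)"
      using 1 x nat_pow_pow[of "inv x" m n] by auto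
    then have "\<exists>n>0. y = inv x [^] (n::nat)" ..
    then show ?thesis
      using inv_closed[OF x] yG y[symmetric] unfolding power_graph_def
      by (simp only: pair_pre_digraph.simps mem_Collect_eq case_prod_conv) blast
  next
    case 2
    obtain m :: nat where "0 < m" "inv x = x [^] m"
      using inv_eq_nat_pow[OF fin x] .
    then have "0 < n * m \<and> inv x = y [^] (n * m)"
      using 2 yG nat_pow_pow[of y n m] by auto
    then have "\<exists>n>0. inv x = y [^] (n::nat)" ..
    then show ?thesis
      using inv_closed[OF x] yG y[symmetric] unfolding power_graph_def
      by (simp only: pair_pre_digraph.simps mem_Collect_eq case_prod_conv) blast
  qed
qed

lemma power_graph_inv_twins:
  assumes fin: "finite (carrier G)" and x: "x \<in> carrier G" and ne: "x \<noteq> inv x"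
  shows "(x, inv x) \<in> parcs (power_graph G)"
    and "insert x (parcs (power_graph G) `` {x}) = insert (inv x) (parcs (power_graph G) `` {inv x})"
proof -
  show adj: "(x, inv x) \<in> parcs (power_graph G)"
    using inv_eq_nat_pow[OF fin x] x ne by (auto simp: power_graph_def)
  have "(inv x, x) \<in> parcs (power_graph G)"
    using adj by (auto simp: power_graph_def)
  then show "insert x (parcs (power_graph G) `` {x}) =
      insert (inv x) (parcs (power_graph G) `` {inv x})"
    using adj power_graph_adj_inv[OF fin x] power_graph_adj_inv[OF fin inv_closed[OF x]] x
    by auto
qed

text \<open>All arcs join distinct elements, so of the equation for arcs in
  \<open>complete_digraph\<close> only one inclusion is left.\<close>

lemma complete_power_graph_iff:
  assumes "finite (carrier G)"
  shows "complete_graph (with_proj (power_graph G)) \<longleftrightarrow>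
    (\<forall>x\<in>carrier G. \<forall>y\<in>carrier G. x \<noteq> y \<longrightarrow> (x, y) \<in> parcs (power_graph G))"
proof -
  interpret \<Gamma>: pair_graph "power_graph G"
    using assms by (rule pair_graph_power_graph)
  have "graph (with_proj (power_graph G))"
    by unfold_locales (rule \<Gamma>.sym_arcs)
  moreover have "arcs_ends (with_proj (power_graph G)) = parcs (power_graph G)"
    by (auto simp: arcs_ends_def arc_to_ends_def)
  moreover have "parcs (power_graph G) \<subseteq> {(x, y). (x, y) \<in> carrier G \<times> carrier G \<and> x \<noteq> y}"
    by (auto simp: power_graph_def)
  ultimately show ?thesis
    by (auto simp: complete_graph_def complete_digraph_def)
qed

section \<open>Groups in which every square is trivial\<close>

lemma power_graph_involutions:
  assumes sq: "\<And>x. x \<in> carrier G \<Longrightarrow> x \<otimes> x = \<one>"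
    and adj: "(x, y) \<in> parcs (power_graph G)"
  shows "x = \<one> \<or> y = \<one>"
proof -
  \<comment> \<open>A power different from \<open>u\<close> is therefore the identity, and adjacent
    vertices are distinct.\<close>
  have "u [^] n \<in> {\<one>, u}" if "u \<in> carrier G" for u and n :: nat
    using that sq by (induction n) auto
  then show ?thesis
    using adj by (fastforce simp: power_graph_def)
qed

lemma generate_involution:
  assumes "x \<in> carrier G" "x \<otimes> x = \<one>"
  shows "generate G {x} = {\<one>, x}"
proof
  have "inv x = x"
    using assms by (simp add: inv_equality)
  then have "subgroup {\<one>, x} G"
    using assms by (auto intro!: subgroupI)
  then show "generate G {x} \<subseteq> {\<one>, x}"
    by (intro generate_subgroup_incl) auto
  show "{\<one>, x} \<subseteq> generate G {x}"
    by (auto intro: generate.one generate.incl)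
qed

text \<open>One element \<open>z\<close> generates only \<open>{\<one>, z}\<close>, so rank at least
  2 amounts to having at least three elements.\<close>

lemma two_le_group_rank_iff:
  assumes fin: "finite (carrier G)" and sq: "\<And>x. x \<in> carrier G \<Longrightarrow> x \<otimes> x = \<one>"
  shows "2 \<le> group_rank G \<longleftrightarrow> (\<exists>x\<in>carrier G. \<exists>y\<in>carrier G. x \<noteq> \<one> \<and> y \<noteq> \<one> \<and> x \<noteq> y)"
proof
  let ?P = "\<lambda>k. \<exists>S\<subseteq>carrier G. finite S \<and> card S = k \<and> generate G S = carrier G"
  {
    assume rank: "2 \<le> group_rank G"
    have gen: "generate G {x} \<noteq> carrier G" if "x \<in> carrier G" for x
    proof
      assume "generate G {x} = carrier G"
      then have "group_rank G \<le> 1"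
        unfolding group_rank_def using that by (intro Least_le exI[of _ "{x}"]) auto
      then show False using rank by simp
    qed
    \<comment> \<open>First \<open>\<one>\<close> and then \<open>x\<close> fails to generate, so
      each time some element lies outside the generated subgroup.\<close>
    obtain x where x: "x \<in> carrier G" "x \<noteq> \<one>"
      using gen[OF one_closed] generate_involution[OF one_closed] by auto
    obtain y where "y \<in> carrier G" "y \<noteq> \<one>" "y \<noteq> x"
      using gen[OF x(1)] generate_involution[OF x(1) sq[OF x(1)]] x by auto
    with x show "\<exists>x\<in>carrier G. \<exists>y\<in>carrier G. x \<noteq> \<one> \<and> y \<noteq> \<one> \<and> x \<noteq> y" by blast
  }
  assume "\<exists>x\<in>carrier G. \<exists>y\<in>carrier G. x \<noteq> \<one> \<and> y \<noteq> \<one> \<and> x \<noteq> y"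
  then obtain x y where xy: "x \<in> carrier G" "y \<in> carrier G" "x \<noteq> \<one>" "y \<noteq> \<one>" "x \<noteq> y" by blast
  have "?P (card (carrier G))"
    using fin generate_incl[of "carrier G"] generate.incl[of _ "carrier G" G] by blast
  then have "?P (group_rank G)"
    unfolding group_rank_def by (rule LeastI)
  then obtain S where S: "S \<subseteq> carrier G" "finite S" "card S = group_rank G"
    "generate G S = carrier G" by blast
  show "2 \<le> group_rank G"
  proof (rule ccontr)
    assume "\<not> 2 \<le> group_rank G"
    then have "card S = 0 \<or> card S = 1" using S by linarith
    \<comment> \<open>An empty \<open>S\<close> is covered by \<open>z = \<one>\<close>.\<close>
    then obtain z where z: "z \<in> carrier G" "S \<subseteq> {z}"
      using S one_closed by (metis card_0_eq card_1_singletonE empty_subsetI insert_subset subset_refl)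
    then have "carrier G \<subseteq> {\<one>, z}"
      using mono_generate[OF z(2)] generate_involution[OF z(1) sq[OF z(1)]] S by simp
    then show False using xy by auto
  qed
qed

lemma elementary_abelian_2_iff:
  "elementary_abelian_group 2 G \<longleftrightarrow> (\<forall>x\<in>carrier G. x \<otimes> x = \<one>)"
proof -
  have "ord x = 2 \<longleftrightarrow> x \<otimes> x = \<one>" if "x \<in> carrier G" "x \<noteq> \<one>" for x
  proof
    assume "ord x = 2"
    then show "x \<otimes> x = \<one>"
      using pow_ord_eq_1[OF that(1)] that by (simp add: numeral_2_eq_2)
  next
    assume "x \<otimes> x = \<one>"
    then have "ord x dvd 2"
      using that by (simp add: numeral_2_eq_2 flip: pow_eq_id)
    then show "ord x = 2"
      using that ord_eq_1 two_is_prime_nat prime_nat_iff by blast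
  qed
  moreover have "comm_group G" if sq: "\<And>x. x \<in> carrier G \<Longrightarrow> x \<otimes> x = \<one>"
  proof (rule group_comm_groupI)
    fix x y assume xy: "x \<in> carrier G" "y \<in> carrier G"
    \<comment> \<open>Every element is its own inverse, so inverting a product only swaps its
      factors.\<close>
    have "inv u = u" if "u \<in> carrier G" for u
      using that sq by (simp add: inv_equality)
    then show "x \<otimes> y = y \<otimes> x"
      using inv_mult_group[OF xy] xy by simp
  qed
  ultimately show ?thesis
    by (auto simp: elementary_abelian_group_def)
qed

section \<open>The two directions of the equivalence\<close>

lemma power_graph_connected:
  assumes "finite (carrier G)"
  shows "connected (with_proj (power_graph G))"
proof -
  have "connected (with_proj (power_graph G) \<restriction> carrier G)"
    by (rule connected_induce_centre[of \<one>]) (auto intro: power_graph_adj_one[OF assms])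
  moreover have "parcs (power_graph G) \<subseteq> carrier G \<times> carrier G"
    by (auto simp: power_graph_def)
  ultimately show ?thesis
    using connected_induce_pverts[of "power_graph G"] by simp
qed

text \<open>A star with at least two leaves has connectivity 1, because its centre separates the
  leaves; deleting any edge isolates a leaf and lowers the connectivity to 0.\<close>

lemma minimally_connected_star:
  assumes fin: "finite (carrier G)" and sq: "\<And>x. x \<in> carrier G \<Longrightarrow> x \<otimes> x = \<one>"
    and xy: "x \<in> carrier G" "y \<in> carrier G" "x \<noteq> \<one>" "y \<noteq> \<one>" "x \<noteq> y"
  shows "minimally_connected (power_graph G)"
proof -
  let ?\<Gamma> = "power_graph G"
  have "card {\<one>, x, y} \<le> card (carrier G)"
    using xy fin by (intro card_mono) auto
  then have card: "3 \<le> card (carrier G)" using xy by simp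
  have star: "u = \<one> \<or> v = \<one>" if "(u, v) \<in> parcs ?\<Gamma>" for u v
    using power_graph_involutions[OF sq that] by blast
  have "vertex_connectivity (with_proj ?\<Gamma>) \<le> 1"
  proof (rule vertex_connectivity_le[of "{\<one>}"])
    have "\<not> connected (with_proj ?\<Gamma> \<restriction> (pverts ?\<Gamma> - {\<one>}))"
      by (rule not_connected_induce[of x _ "{x}" y]) (use xy star in auto)
    then show "\<not> connected (with_proj ?\<Gamma> \<restriction> (pverts ?\<Gamma> - {\<one>})) \<or> card (pverts ?\<Gamma> - {\<one>}) = 1" ..
  qed auto
  moreover have "vertex_connectivity (with_proj ?\<Gamma>) \<noteq> 0"
  proof
    assume "vertex_connectivity (with_proj ?\<Gamma>) = 0"
    then obtain S where "S \<subseteq> carrier G" "finite S" "card S = 0"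
      "\<not> connected (with_proj ?\<Gamma> \<restriction> (carrier G - S)) \<or> card (carrier G - S) = 1"
      using vertex_connectivity_witness[of ?\<Gamma>] fin by auto
    moreover have "parcs ?\<Gamma> \<subseteq> carrier G \<times> carrier G"
      by (auto simp: power_graph_def)
    \<comment> \<open>Here \<open>S\<close> is empty: the graph is connected, and three elements are
      too many for the single-vertex clause.\<close>
    ultimately show False
      using card power_graph_connected[OF fin] connected_induce_pverts[of ?\<Gamma>] by auto
  qed
  ultimately have \<kappa>: "vertex_connectivity (with_proj ?\<Gamma>) = 1" by simp
  have "vertex_connectivity (with_proj (delete_edge ?\<Gamma> e)) = 0" if e: "e \<in> parcs ?\<Gamma>" for e
  proof -
    obtain u v where uv: "e = (u, v)" by (cases e)
    then have "u \<in> carrier G" "v \<in> carrier G" "u \<noteq> v"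
      using e by (auto simp: power_graph_def)
    then obtain a where a: "a \<in> carrier G" "a \<noteq> \<one>" "e = (a, \<one>) \<or> e = (\<one>, a)"
      using star e uv by blast
    have "\<not> connected (with_proj (delete_edge ?\<Gamma> e) \<restriction> carrier G)"
      by (rule not_connected_induce[of a _ "{a}" \<one>])
        (use a in \<open>auto simp: delete_edge_def dest: star\<close>)
    then have "vertex_connectivity (with_proj (delete_edge ?\<Gamma> e)) \<le> 0"
      by (intro vertex_connectivity_le[of "{}"]) (auto simp: delete_edge_def)
    then show ?thesis by simp
  qed
  then show ?thesis
    using \<kappa> card power_graph_connected[OF fin] by (auto simp: minimally_connected_def)
qed

text \<open>If \<open>x\<close> differs from its inverse, the edge to the identity bounds the degree
  of \<open>x\<close> by the connectivity, whereas the twins \<open>x\<close> and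
  \<open>inv x\<close> force a larger degree.\<close>

lemma minimally_connected_imp_involutions:
  assumes fin: "finite (carrier G)"
    and noncomplete: "\<not> complete_graph (with_proj (power_graph G))"
    and min: "minimally_connected (power_graph G)"
    and x: "x \<in> carrier G"
  shows "x \<otimes> x = \<one>"
proof (rule ccontr)
  let ?\<Gamma> = "power_graph G" and ?k = "vertex_connectivity (with_proj (power_graph G))"
  note \<Gamma> = pair_graph_power_graph[OF fin]
  assume sq: "x \<otimes> x \<noteq> \<one>"
  have ne: "x \<noteq> \<one>" "x \<noteq> inv x"
    using sq x by (auto, metis r_inv)
  obtain u v where uv: "u \<in> carrier G" "v \<in> carrier G" "u \<noteq> v" "(u, v) \<notin> parcs ?\<Gamma>"
    using noncomplete complete_power_graph_iff[OF fin] by blast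
  then have "(v, u) \<notin> parcs ?\<Gamma>" by (auto simp: power_graph_def)
  then have k_le: "?k + 2 \<le> card (carrier G)"
    using vertex_connectivity_nonadjacent[of ?\<Gamma> u v] fin uv by simp
  have "(\<one>, x) \<in> parcs ?\<Gamma>"
    using power_graph_adj_one[OF fin x ne(1)] by (auto simp: power_graph_def)
  then have drop: "Suc (vertex_connectivity (with_proj (delete_edge ?\<Gamma> (\<one>, x)))) = ?k"
    using min by (fastforce simp: minimally_connected_def)
  have deg: "card (parcs ?\<Gamma> `` {x}) \<le> ?k"
    using degree_le_vertex_connectivity_of_centre_edge[OF \<Gamma> _ _ _ ne(1) _ drop] k_le x
      power_graph_adj_one[OF fin] by simp
  \<comment> \<open>Otherwise the degree of \<open>x\<close> would be
    \<open>card (carrier G) - 1\<close>, which is at least \<open>?k + 1\<close>.\<close>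
  have "\<exists>z\<in>carrier G. z \<noteq> x \<and> (x, z) \<notin> parcs ?\<Gamma>"
  proof (rule ccontr)
    assume "\<not> (\<exists>z\<in>carrier G. z \<noteq> x \<and> (x, z) \<notin> parcs ?\<Gamma>)"
    then have "parcs ?\<Gamma> `` {x} = carrier G - {x}"
      by (auto simp: power_graph_def)
    then show False using deg k_le x by simp
  qed
  then obtain z where "z \<in> carrier G" "z \<noteq> x" "(x, z) \<notin> parcs ?\<Gamma>" by blast
  then show False
    using vertex_connectivity_less_degree_of_twins[OF \<Gamma> power_graph_inv_twins(1) ne(2)
        power_graph_inv_twins(2), of z] fin x ne deg by simp
qed

end

theorem theorem1p2:
  fixes G :: "('a, 'm) monoid_scheme"
  assumes "group G" and "finite (carrier G)"
  shows "elementary_abelian_group 2 G \<and> 2 \<le> group_rank G \<longleftrightarrow>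
    \<not> complete_graph (with_proj (power_graph G)) \<and> minimally_connected (power_graph G)"
proof -
  interpret group G by fact
  note fin = assms(2)
  show ?thesis
  proof
    assume L: "elementary_abelian_group 2 G \<and> 2 \<le> group_rank G"
    then have sq: "\<And>x. x \<in> carrier G \<Longrightarrow> x \<otimes>\<^bsub>G\<^esub> x = \<one>\<^bsub>G\<^esub>"
      by (simp add: elementary_abelian_2_iff)
    then obtain x y where xy: "x \<in> carrier G" "y \<in> carrier G" "x \<noteq> \<one>\<^bsub>G\<^esub>" "y \<noteq> \<one>\<^bsub>G\<^esub>" "x \<noteq> y"
      using L two_le_group_rank_iff[OF fin] by blast
    then have "(x, y) \<notin> parcs (power_graph G)"
      using power_graph_involutions[OF sq] by blast
    then show "\<not> complete_graph (with_proj (power_graph G)) \<and> minimally_connected (power_graph G)"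
      using complete_power_graph_iff[OF fin] minimally_connected_star[OF fin sq] xy by blast
  next
    assume R: "\<not> complete_graph (with_proj (power_graph G)) \<and> minimally_connected (power_graph G)"
    then have sq: "\<And>x. x \<in> carrier G \<Longrightarrow> x \<otimes>\<^bsub>G\<^esub> x = \<one>\<^bsub>G\<^esub>"
      using minimally_connected_imp_involutions[OF fin] by blast
    \<comment> \<open>Non-adjacent vertices both differ from the identity, which is adjacent to
      everything else, so they serve as the two elements in the rank criterion.\<close>
    obtain u v where uv: "u \<in> carrier G" "v \<in> carrier G" "u \<noteq> v" "(u, v) \<notin> parcs (power_graph G)"
      using R complete_power_graph_iff[OF fin] by blast
    moreover have "(v, u) \<notin> parcs (power_graph G)"
      using uv by (auto simp: power_graph_def)
    ultimately have "u \<noteq> \<one>\<^bsub>G\<^esub>" "v \<noteq> \<one>\<^bsub>G\<^esub>"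
      using power_graph_adj_one[OF fin] by metis+
    then show "elementary_abelian_group 2 G \<and> 2 \<le> group_rank G"
      using uv two_le_group_rank_iff[OF fin sq] sq by (auto simp: elementary_abelian_2_iff)
  qed
qed

end
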